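(* For $\epsilon>0$ let $\{Q_{e,\epsilon}\}_{e\in\mathcal E}$ be smooth approximations of the monotone rearrangements $Q_e(\cdot;S_e)$ such that $Q_{e,\epsilon}\in C^2([0,l_e])$, $Q_{e,\epsilon}'>0$, and $\lim_{\epsilon\downarrow0}\max_{e\in\mathcal E}\|Q_{e,\epsilon}(\cdot)-Q_e(\cdot;S_e)\|_{L^1(0,l_e)}=0$. Let $Z=Z(\epsilon)$ be the optimal value of $$\min_{\mathbf c\in\mathbb R^{|\mathcal E|}}\ \sum_{e\in\mathcal E}\Psi_e(c_e;Q_{e,\epsilon})\quad\text{s.t.}\quad\mathbf I\mathbf c=\mathbf I^+\mathbf s,$$ and let $Z^{\mathrm{CF}}$ be the optimal value of $\min_{\mathbf c\in\mathbb Z^{|\mathcal E|}}\sum_{e\in\mathcal E}\Psi_e(c_e;S_e)$ subject to $\mathbf I\mathbf c=\mathbf I^+\mathbf s$ (which equals the optimal total matching distance on the network). Then $$\lim_{\epsilon\downarrow0}|Z-Z^{\mathrm{CF}}|=0 .$$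
   Context: $(\mathcal V,\mathcal E)$ is an undirected network. Each edge $e\in\mathcal E$ has length $l_e\ge 0$ and end nodes $v_e^-,v_e^+\in\mathcal V$ (an arbitrary orientation from $v_e^-$ to $v_e^+$ is fixed). A location on $e$ is recorded as $(e,x)$, $x\in[0,l_e]$, where $x$ is the distance from $v_e^-$ along $e$. Put $\mathcal L_e(x)=\{(e,y):y\in[0,x]\}$ and $\mathcal L=\bigcup_{e}\mathcal L_e(l_e)$. $U,V\subset\mathcal L$ are finite sets of supply and demand points with $|U|=|V|=n$. The imbalance profile of edge $e$ is $S_e(x)=|U\cap\mathcal L_e(x)|-|V\cap\mathcal L_e(x)|$ for $x\in[0,l_e]$, and $\mathbf s=(S_e(l_e))_{e\in\mathcal E}$. For a profile $\xi_e:[0,l_e]\to\mathbb R$ and $c\in\mathbb R$: $\Psi_e(c;\xi_e)=\int_0^{l_e}|\xi_e(x)-c|\,dx$; $F_e(c;\xi_e)$ is the Lebesgue measure of $\{x\in[0,l_e]:\xi_e(x)\le c\}$; and $Q_e(t;\xi_e)=\inf\{c:F_e(c;\xi_e)\ge t\}$. $\mathbf I^+$ (resp. $\mathbf I^-$) is the $\mathcal V\times\mathcal E$ matrix whose $(v,e)$ entry is $1$ if $v_e^+=v$ (resp. $v_e^-=v$) and $0$ otherwise; $\mathbf I=\mathbf I^+-\mathbf I^-$. *)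

theory Defs
  imports "HOL-Analysis.Analysis"
begin

text \<open>A network is given by finite types \<open>'v\<close> of nodes and \<open>'e\<close> of edges, the length
  \<open>len e\<close> of each edge and its end nodes \<open>tail e\<close> (written \<open>v_e^-\<close> in the literature) and
  \<open>head e\<close> (\<open>v_e^+\<close>).  Loops and parallel edges are allowed.  The pair \<open>(e, x)\<close> is the
  location on \<open>e\<close> at distance \<open>x\<close> from \<open>tail e\<close>.\<close>

definition edge_prefix :: "'e \<Rightarrow> real \<Rightarrow> ('e \<times> real) set" where
  "edge_prefix e x = {(e, y) | y. y \<in> {0..x}}"

definition locations :: "('e \<Rightarrow> real) \<Rightarrow> ('e \<times> real) set" where
  "locations len = (\<Union>e. edge_prefix e (len e))"

definition imbalance ::
    "('e \<times> real) set \<Rightarrow> ('e \<times> real) set \<Rightarrow> 'e \<Rightarrow> real \<Rightarrow> real" where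
  "imbalance U V e x = real (card (U \<inter> edge_prefix e x)) - real (card (V \<inter> edge_prefix e x))"

definition end_imbalance ::
    "('e::finite \<Rightarrow> real) \<Rightarrow> ('e \<times> real) set \<Rightarrow> ('e \<times> real) set \<Rightarrow> real ^ 'e" where
  "end_imbalance len U V = (\<chi> e. imbalance U V e (len e))"

text \<open>In the next four definitions \<open>l\<close> is the length of the edge; only the values of the
  profile \<open>\<xi>\<close> on \<open>{0..l}\<close> matter.\<close>

definition Psi :: "real \<Rightarrow> (real \<Rightarrow> real) \<Rightarrow> real \<Rightarrow> real" where
  "Psi l \<xi> c = (LINT x:{0..l}|lebesgue. \<bar>\<xi> x - c\<bar>)"

definition sublevel_measure :: "real \<Rightarrow> (real \<Rightarrow> real) \<Rightarrow> real \<Rightarrow> real" where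
  "sublevel_measure l \<xi> c = measure lebesgue {x \<in> {0..l}. \<xi> x \<le> c}"

text \<open>At \<open>t = 0\<close> the set below is all of \<open>\<real>\<close>, whose infimum would be \<open>-\<infinity>\<close>; the value of the
  real-valued \<^const>\<open>Inf\<close> there is arbitrary.  This single point is
  irrelevant, since rearrangements are only compared in \<open>L\<^sup>1(0, l)\<close>.\<close>

definition rearrangement :: "real \<Rightarrow> (real \<Rightarrow> real) \<Rightarrow> real \<Rightarrow> real" where
  "rearrangement l \<xi> t = Inf {c. sublevel_measure l \<xi> c \<ge> t}"

definition L1_dist :: "real \<Rightarrow> (real \<Rightarrow> real) \<Rightarrow> (real \<Rightarrow> real) \<Rightarrow> real" where
  "L1_dist l f g = (LINT x:{0<..<l}|lebesgue. \<bar>f x - g x\<bar>)"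

definition C2_on :: "(real \<Rightarrow> real) \<Rightarrow> real set \<Rightarrow> bool" where
  "C2_on f A \<longleftrightarrow> (\<exists>f' f''.
     (\<forall>x\<in>A. (f has_real_derivative f' x) (at x within A) \<and>
            (f' has_real_derivative f'' x) (at x within A)) \<and>
     continuous_on A f'')"

text \<open>Derivatives are one-sided at the end points.  Stated existentially because on an edge of
  length 0 the derivative within the interval is not unique.\<close>

definition pos_deriv_on :: "(real \<Rightarrow> real) \<Rightarrow> real set \<Rightarrow> bool" where
  "pos_deriv_on f A \<longleftrightarrow> (\<forall>x\<in>A. \<exists>D>0. (f has_real_derivative D) (at x within A))"

definition incidence_at :: "('e::finite \<Rightarrow> 'v::finite) \<Rightarrow> real ^ 'e ^ 'v" where
  "incidence_at f = (\<chi> v e. if f e = v then 1 else 0)"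

definition feasible ::
    "('e::finite \<Rightarrow> 'v::finite) \<Rightarrow> ('e \<Rightarrow> 'v) \<Rightarrow> real ^ 'e \<Rightarrow> (real ^ 'e) set" where
  "feasible tail head s =
     {c. (incidence_at head - incidence_at tail) *v c = incidence_at head *v s}"

definition total_cost ::
    "('e::finite \<Rightarrow> real) \<Rightarrow> ('e \<Rightarrow> real \<Rightarrow> real) \<Rightarrow> real ^ 'e \<Rightarrow> real" where
  "total_cost len \<xi> c = (\<Sum>e\<in>UNIV. Psi (len e) (\<xi> e) (c $ e))"

text \<open>Costs are nonnegative, so both infima are genuine whenever the constraint set is nonempty.\<close>

definition real_optimum ::
    "('e::finite \<Rightarrow> real) \<Rightarrow> ('e \<Rightarrow> 'v::finite) \<Rightarrow> ('e \<Rightarrow> 'v) \<Rightarrow> real ^ 'e \<Rightarrow>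
     ('e \<Rightarrow> real \<Rightarrow> real) \<Rightarrow> real" where
  "real_optimum len tail head s \<xi> = (INF c \<in> feasible tail head s. total_cost len \<xi> c)"

definition int_optimum ::
    "('e::finite \<Rightarrow> real) \<Rightarrow> ('e \<Rightarrow> 'v::finite) \<Rightarrow> ('e \<Rightarrow> 'v) \<Rightarrow> real ^ 'e \<Rightarrow>
     ('e \<Rightarrow> real \<Rightarrow> real) \<Rightarrow> real" where
  "int_optimum len tail head s \<xi> =
     (INF c \<in> {c \<in> feasible tail head s. \<forall>e. c $ e \<in> \<int>}. total_cost len \<xi> c)"

end

theory Submission
  imports Defs "HOL-Probability.Weak_Convergence"
begin

text \<open>The rearrangement of a profile has the same distribution as the profile under Lebesgue
  measure, so it defines the same cost \<^const>\<open>Psi\<close>, and replacing it by an \<open>L\<^sup>1\<close>-close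
  function changes the cost, hence the optimal value, by at most the \<open>L\<^sup>1\<close> distance, uniformly in
  \<open>c\<close>.  It remains to see that for integer-valued profiles the real and the integer optimum
  coincide.  In a real feasible point \<open>c\<close>, flow conservation with integer right-hand side forces
  every node touched by a fractional edge to have degree at least 2 in the set of fractional edges;
  by a dimension count that set supports a nonzero circulation \<open>d\<close>.  The cost is affine on the
  integer unit cell containing \<open>c\<close>, so moving along one of \<open>\<plusminus>d\<close> to the boundary of the cell does
  not increase it, while the number of fractional edges drops.\<close>

section \<open>Rearrangements and costs\<close>

text \<open>The end points of the edge are left out because
  \<^const>\<open>rearrangement\<close> has an arbitrary value at \<open>0\<close>.\<close>

abbreviation edge_measure :: "real \<Rightarrow> real measure" where
  "edge_measure l \<equiv> restrict_space lborel {0<..<l}"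

lemma finite_measure_edge_measure: "finite_measure (edge_measure l)"
  by (rule finite_measureI) (cases "l \<ge> 0"; simp add: emeasure_restrict_space space_restrict_space)

text \<open>\<open>Psi\<close> integrates over the closed interval and \<open>L1_dist\<close> over
  the open one, both against \<open>lebesgue\<close>. The end points are null, so both become
  integrals over \<open>edge_measure\<close>.\<close>

lemma set_lebesgue_integral_edge:
  fixes g :: "real \<Rightarrow> real"
  assumes g: "g \<in> borel_measurable (edge_measure l)"
  shows "(LINT x:{0<..<l}|lebesgue. g x) = integral\<^sup>L (edge_measure l) g" (is ?open)
    and "(LINT x:{0..l}|lebesgue. g x) = integral\<^sup>L (edge_measure l) g" (is ?closed)
proof -
  have m: "(\<lambda>x. indicator {0<..<l} x *\<^sub>R g x) \<in> borel_measurable lborel"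
    using g by (subst (asm) borel_measurable_restrict_space_iff) auto
  show ?open
    unfolding set_lebesgue_integral_def
    by (subst integral_completion[OF m], subst integral_restrict_space) auto
  \<comment> \<open>Nothing is known about \<open>g\<close> at the end points, but altering a Borel
    function at two points keeps it Borel. The tests \<open>0 \<le> l\<close> cover the empty
    interval.\<close>
  have eq: "(\<lambda>x. indicator {0..l} x *\<^sub>R g x) =
      (\<lambda>x. if x = 0 \<or> x = l then (if x = 0 then if 0 \<le> l then g 0 else 0 else if 0 \<le> l then g l else 0)
        else indicator {0<..<l} x *\<^sub>R g x)"
    by (auto simp: fun_eq_iff indicator_def)
  have m': "(\<lambda>x. indicator {0..l} x *\<^sub>R g x) \<in> borel_measurable lborel"
    unfolding eq using m by measurable
  have "AE x in lborel. indicator {0..l} x *\<^sub>R g x = indicator {0<..<l} x *\<^sub>R g x"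
    using AE_lborel_singleton[of 0] AE_lborel_singleton[of l]
    by eventually_elim (auto simp: indicator_def)
  then show ?closed
    unfolding set_lebesgue_integral_def
    by (subst integral_completion[OF m'], subst integral_restrict_space)
       (simp, rule integral_cong_AE[OF m' m])
qed

lemma Psi_eq:
  assumes "f \<in> borel_measurable (edge_measure l)"
  shows "Psi l f c = (LINT x|edge_measure l. \<bar>f x - c\<bar>)"
  unfolding Psi_def by (rule set_lebesgue_integral_edge) (use assms in measurable)

lemma L1_dist_eq:
  assumes "f \<in> borel_measurable (edge_measure l)" "g \<in> borel_measurable (edge_measure l)"
  shows "L1_dist l f g = (LINT x|edge_measure l. \<bar>f x - g x\<bar>)"
  unfolding L1_dist_def by (rule set_lebesgue_integral_edge) (use assms in measurable)

text \<open>Turns the rearrangement into the quantile function of a finite Borel measure, so that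
  the theory of \<open>cdf\<close> applies to it.\<close>

lemma sublevel_measure_eq_cdf:
  assumes f: "f \<in> borel_measurable (edge_measure l)"
  shows "sublevel_measure l f = cdf (distr (edge_measure l) borel f)"
proof
  fix c
  have "sublevel_measure l f c = (LINT x:{0..l}|lebesgue. indicator {..c} (f x))"
    unfolding sublevel_measure_def set_lebesgue_integral_def
    by (subst Bochner_Integration.integral_cong[OF refl,
          where g = "indicator {x \<in> {0..l}. f x \<le> c}"]) (auto simp: indicator_def)
  also have "\<dots> = (LINT x|edge_measure l. indicator {..c} (f x))"
    by (rule set_lebesgue_integral_edge) (use f in measurable)
  also have "\<dots> = (LINT y|distr (edge_measure l) borel f. indicator {..c} y)"
    by (rule integral_distr[symmetric]) (use f in auto)
  also have "\<dots> = cdf (distr (edge_measure l) borel f) c"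
    by (simp add: cdf_def)
  finally show "sublevel_measure l f c = cdf (distr (edge_measure l) borel f) c" .
qed

lemma finite_borel_measure_distr_edge:
  assumes f: "f \<in> borel_measurable (edge_measure l)"
  shows "finite_borel_measure (distr (edge_measure l) borel f)"
proof -
  interpret finite_measure "distr (edge_measure l) borel f"
    using finite_measure_edge_measure[of l] f by (rule finite_measure.finite_measure_distr)
  show ?thesis by unfold_locales simp
qed

text \<open>The rearrangement is the generalized inverse \<open>I\<close> of \<open>cdf ?D\<close>:
  for \<open>0 < t < l\<close>, \<open>I t \<le> c\<close> iff \<open>t \<le> cdf ?D c\<close>.
  Hence its sublevel set at \<open>c\<close> has length \<open>cdf ?D c\<close>, and equal
  distribution functions force equal measures.\<close>

lemma
  assumes l: "l \<ge> 0" and f: "f \<in> borel_measurable (edge_measure l)"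
  shows measurable_rearrangement: "rearrangement l f \<in> borel_measurable (edge_measure l)"
    and distr_rearrangement:
      "distr (edge_measure l) borel (rearrangement l f) = distr (edge_measure l) borel f"
proof -
  let ?D = "distr (edge_measure l) borel f"
  interpret finite_borel_measure ?D
    by (rule finite_borel_measure_distr_edge[OF f])
  have total: "measure ?D (space ?D) = l"
    using f l by (simp add: measure_distr space_restrict_space measure_restrict_space)
  interpret right_continuous_mono "cdf ?D" 0 l
    using cdf_lim_at_top[unfolded total]
    by unfold_locales (auto intro: cdf_nondecreasing cdf_is_right_cont cdf_lim_at_bot monoI)
  have R: "rearrangement l f = I"
    unfolding rearrangement_def sublevel_measure_eq_cdf[OF f] by (rule refl)
  show m: "rearrangement l f \<in> borel_measurable (edge_measure l)"
    unfolding R using borel_measurable_mono_on_fnc[OF mono_I]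
    by (simp add: measurable_def space_restrict_space sets_restrict_space)
  show "distr (edge_measure l) borel (rearrangement l f) = ?D"
  proof (intro cdf_unique' ext finite_borel_measure_distr_edge m f)
    fix c
    have "cdf (distr (edge_measure l) borel (rearrangement l f)) c
        = measure lborel {t \<in> {0<..<l}. t \<le> cdf ?D c}"
      using m unfolding cdf_def2[of "distr _ _ (rearrangement l f)"]
      by (auto simp: R pseudoinverse[symmetric] measure_distr space_restrict_space measure_restrict_space
          intro!: arg_cong2[where f=measure])
    \<comment> \<open>Since \<open>cdf ?D c \<le> l\<close>, the two sets differ at most in the
      point \<open>cdf ?D c\<close>, which is null.\<close>
    also have "\<dots> = measure lborel {0<..<cdf ?D c}"
      using cdf_bounded[of c, unfolded total] AE_lborel_singleton[of "cdf ?D c"]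
      by (auto simp: measure_def intro!: arg_cong[where f=enn2real] emeasure_eq_AE)
    also have "\<dots> = cdf ?D c"
      by (simp add: cdf_nonneg)
    finally show "cdf (distr (edge_measure l) borel (rearrangement l f)) c = cdf ?D c" .
  qed
qed

text \<open>\<open>Psi\<close> is the integral of \<open>\<bar>y - c\<bar>\<close> against the
  distribution of the profile, which the rearrangement preserves.\<close>

lemma Psi_rearrangement:
  assumes l: "l \<ge> 0" and f: "f \<in> borel_measurable (edge_measure l)"
  shows "Psi l (rearrangement l f) c = Psi l f c"
proof -
  note m = measurable_rearrangement[OF l f]
  have "Psi l (rearrangement l f) c
      = (LINT y|distr (edge_measure l) borel (rearrangement l f). \<bar>y - c\<bar>)"
    using m by (subst integral_distr) (auto simp: Psi_eq)
  also have "\<dots> = Psi l f c"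
    using f by (simp add: distr_rearrangement[OF l f] integral_distr Psi_eq)
  finally show ?thesis .
qed

lemma integrable_rearrangement:
  assumes l: "l \<ge> 0" and f: "integrable (edge_measure l) f"
  shows "integrable (edge_measure l) (rearrangement l f)"
proof -
  have fm: "f \<in> borel_measurable (edge_measure l)"
    using f by (rule borel_measurable_integrable)
  have "integrable (distr (edge_measure l) borel f) (\<lambda>y. y)"
    using f fm by (simp add: integrable_distr_eq)
  then show ?thesis
    unfolding distr_rearrangement[OF l fm, symmetric]
    using measurable_rearrangement[OF l fm] by (simp add: integrable_distr_eq)
qed

section \<open>L1 stability of the cost and integrability of the profiles\<close>

text \<open>The reverse triangle inequality, integrated. The bound does not involve
  \<open>c\<close>, so it survives the infimum over \<open>c\<close>.\<close>

lemma Psi_diff_le_L1_dist: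
  assumes f: "integrable (edge_measure l) f" and g: "integrable (edge_measure l) g"
  shows "\<bar>Psi l f c - Psi l g c\<bar> \<le> L1_dist l f g"
proof -
  interpret finite_measure "edge_measure l"
    by (rule finite_measure_edge_measure)
  note [measurable] = borel_measurable_integrable[OF f] borel_measurable_integrable[OF g]
  have "Psi l f c - Psi l g c = (LINT x|edge_measure l. \<bar>f x - c\<bar> - \<bar>g x - c\<bar>)"
    using f g by (simp add: Psi_eq)
  also have "\<bar>\<dots>\<bar> \<le> (LINT x|edge_measure l. \<bar>f x - g x\<bar>)"
    by (rule integral_abs_bound_integral) (use f g in auto)
  finally show ?thesis
    by (simp add: L1_dist_eq)
qed

lemma integrable_continuous_edge:
  fixes f :: "real \<Rightarrow> real"
  assumes "continuous_on {0..l} f"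
  shows "integrable (edge_measure l) f"
proof -
  have "set_integrable lborel {0..l} f"
    using assms by (rule borel_integrable_atLeastAtMost')
  then have "set_integrable lborel {0<..<l} f"
    by (rule set_integrable_subset) auto
  then show ?thesis
    by (simp add: integrable_restrict_space set_integrable_def)
qed

text \<open>The two counting functions are nondecreasing, hence Borel, and bounded by the sizes of
  finite sets; the edge has finite measure.\<close>

lemma integrable_imbalance:
  assumes "finite U" "finite V"
  shows "integrable (edge_measure l) (imbalance U V e)"
proof -
  interpret finite_measure "edge_measure l"
    by (rule finite_measure_edge_measure)
  have mono: "mono (\<lambda>x. real (card (W \<inter> edge_prefix e x)))" if "finite W" for W
    using that by (intro monoI of_nat_mono card_mono) (auto simp: edge_prefix_def)
  have le: "card (W \<inter> edge_prefix e x) \<le> card W" if "finite W" for W x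
    using that by (intro card_mono) auto
  have "imbalance U V e \<in> borel_measurable borel"
    unfolding imbalance_def
    by (intro borel_measurable_diff borel_measurable_mono mono assms)
  then have "imbalance U V e \<in> borel_measurable (edge_measure l)"
    by (intro measurable_restrict_space1) simp
  moreover have "\<bar>imbalance U V e x\<bar> \<le> card U + card V" for x
    using le[OF assms(1), of x] le[OF assms(2), of x] by (simp add: imbalance_def)
  ultimately show ?thesis
    by (intro integrable_const_bound[where B = "real (card U + card V)"]) auto
qed

section \<open>Integrality of the optimum\<close>

lemma incidence_at_mult:
  "(incidence_at f *v c) $ v = (\<Sum>e | f e = v. c $ e)"
  by (simp add: incidence_at_def matrix_vector_mult_def if_distrib[of "\<lambda>x. x * _"]
      sum.If_cases cong: if_cong)

text \<open>Each edge has exactly one node \<open>f e\<close>, so all column sums are 1. Used for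
  \<open>head\<close> and \<open>tail\<close>, this puts the values of the node-arc map among the
  vectors with coordinate sum 0.\<close>

lemma sum_incidence_at_mult:
  fixes f :: "'e::finite \<Rightarrow> 'v::finite"
  shows "(\<Sum>v\<in>UNIV. (incidence_at f *v c) $ v) = (\<Sum>e\<in>UNIV. c $ e)"
  using sum.group[of UNIV UNIV f "($) c"] by (simp add: incidence_at_mult)

text \<open>If the node-arc map were injective on vectors supported on \<open>F\<close>, then \<open>card F\<close> would be
  less than the number of touched nodes, since its values sum to zero; but counting degrees
  (a loop counts twice) gives the opposite inequality.\<close>

lemma exists_circulation:
  fixes tail head :: "'e::finite \<Rightarrow> 'v::finite" and F :: "'e set"
  assumes "F \<noteq> {}"
    and deg: "\<And>v. v \<in> head ` F \<union> tail ` F \<Longrightarrow>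
      2 \<le> card {e \<in> F. head e = v} + card {e \<in> F. tail e = v}"
  obtains d :: "real ^ 'e" where "d \<noteq> 0" "\<And>e. e \<notin> F \<Longrightarrow> d $ e = 0"
    "(incidence_at head - incidence_at tail) *v d = 0"
proof -
  define f :: "real ^ 'e \<Rightarrow> real ^ 'v"
    where "f = (*v) (incidence_at head - incidence_at tail)"
  define W where "W = head ` F \<union> tail ` F"
  define X where "X = {x::real^'e. \<forall>e. e \<notin> F \<longrightarrow> x $ e = 0}"
  define Y where "Y = {y::real^'v. \<forall>v. v \<notin> W \<longrightarrow> y $ v = 0}"
  define Y0 where "Y0 = {y \<in> Y. (\<Sum>v\<in>UNIV. y $ v) = 0}"
  have lin: "linear f"
    unfolding f_def by (rule matrix_vector_mul_linear)
  have f_nth: "f x $ v = (\<Sum>e | head e = v. x $ e) - (\<Sum>e | tail e = v. x $ e)" for x v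
    unfolding f_def matrix_vector_mult_diff_rdistrib by (simp add: incidence_at_mult)
  have subX: "subspace X" and subY: "subspace Y" and subY0: "subspace Y0"
    unfolding X_def Y_def Y0_def
    by (auto simp: subspace_def sum.distrib simp flip: sum_distrib_left)
  have dims: "dim X = card F" "dim Y = card W"
    unfolding X_def Y_def by (simp_all add: dim_substandard_cart flip: dim_vec_eq)
  have "f ` X \<subseteq> Y0"
  proof
    fix y assume "y \<in> f ` X"
    then obtain x where x: "x \<in> X" "y = f x" by blast
    have "f x $ v = 0" if "v \<notin> W" for v
    proof -
      have "x $ e = 0" if "head e = v \<or> tail e = v" for e
        using that \<open>v \<notin> W\<close> x(1) by (auto simp: X_def W_def)
      then show ?thesis by (simp add: f_nth)
    qed
    moreover have "(\<Sum>v\<in>UNIV. f x $ v) = 0"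
      unfolding f_def matrix_vector_mult_diff_rdistrib
      by (simp add: sum_subtractf sum_incidence_at_mult)
    ultimately show "y \<in> Y0"
      using x(2) by (simp add: Y0_def Y_def)
  qed
  obtain w where w: "w \<in> W"
    using \<open>F \<noteq> {}\<close> by (auto simp: W_def)
  \<comment> \<open>\<open>axis w 1\<close> has coordinate sum 1, so the zero-sum condition cuts out
    a proper subspace and costs a dimension.\<close>
  then have "axis w 1 \<in> Y - Y0"
    by (auto simp: Y_def Y0_def axis_def)
  then have "Y0 \<subset> Y"
    by (auto simp: Y0_def)
  then have "dim Y0 < dim Y"
    using subY subY0 by (intro dim_psubset) (simp add: span_eq_iff[THEN iffD2])
  have "2 * card W \<le> (\<Sum>v\<in>W. card {e \<in> F. head e = v} + card {e \<in> F. tail e = v})"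
    using sum_bounded_below[of W 2 "\<lambda>v. card {e \<in> F. head e = v} + card {e \<in> F. tail e = v}"] deg
    by (simp add: W_def mult.commute)
  also have "\<dots> = 2 * card F"
    using sum.group[of F W head "\<lambda>_. 1::nat"] sum.group[of F W tail "\<lambda>_. 1::nat"]
    by (simp add: sum.distrib W_def)
  finally have "card W \<le> card F" by simp
  have "\<not> inj_on f X"
  proof
    assume "inj_on f X"
    \<comment> \<open>Injectivity would give
      \<open>card F = dim X \<le> dim Y0 < dim Y = card W \<le> card F\<close>.\<close>
    then have "dim (f ` X) = dim X"
      using lin subX by (intro dim_image_eq) (simp_all add: span_eq_iff[THEN iffD2])
    with dim_subset[OF \<open>f ` X \<subseteq> Y0\<close>] \<open>dim Y0 < dim Y\<close> \<open>card W \<le> card F\<close> dims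
    show False by simp
  qed
  then obtain x where "x \<in> X" "f x = 0" "x \<noteq> 0"
    using linear_injective_on_subspace_0[OF lin subX] by blast
  then show thesis
    using that[of x] by (simp add: X_def f_def)
qed

lemma feasible_iff:
  "c \<in> feasible tail head s \<longleftrightarrow>
    (\<forall>v. (\<Sum>e | head e = v. c $ e) - (\<Sum>e | tail e = v. c $ e) = (\<Sum>e | head e = v. s $ e))"
  by (simp add: feasible_def vec_eq_iff matrix_vector_mult_diff_rdistrib incidence_at_mult)

lemma feasible_add_circulation:
  assumes "c \<in> feasible tail head s" "(incidence_at head - incidence_at tail) *v d = 0"
  shows "c + t *\<^sub>R d \<in> feasible tail head s"
  using assms by (simp add: feasible_def matrix_vector_right_distrib matrix_vector_mult_scaleR)

text \<open>If a single fractional edge end met \<open>v\<close>, conservation at \<open>v\<close>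
  would express that flow, up to sign, through integers. A loop counts in both \<open>?H\<close> and
  \<open>?T\<close>, so it has degree 2 by itself.\<close>

lemma fractional_degree:
  fixes c :: "real ^ 'e::finite"
  assumes c: "c \<in> feasible tail head s" and s: "\<And>e. s $ e \<in> \<int>"
    and v: "v \<in> head ` {e. c $ e \<notin> \<int>} \<union> tail ` {e. c $ e \<notin> \<int>}"
  shows "2 \<le> card {e \<in> {e. c $ e \<notin> \<int>}. head e = v} + card {e \<in> {e. c $ e \<notin> \<int>}. tail e = v}"
    (is "2 \<le> card ?H + card ?T")
proof (rule ccontr)
  assume "\<not> ?thesis"
  then have less: "card ?H + card ?T < 2" by simp
  have split: "(\<Sum>e | h e = v. c $ e) =
      (\<Sum>e\<in>{e \<in> {e. c $ e \<notin> \<int>}. h e = v}. c $ e) + (\<Sum>e | c $ e \<in> \<int> \<and> h e = v. c $ e)" for h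
    by (subst sum.union_disjoint[symmetric]) (auto intro!: sum.cong)
  have int: "(\<Sum>e | c $ e \<in> \<int> \<and> h e = v. c $ e) \<in> \<int>" for h
    by (rule Ints_sum) auto
  have "(\<Sum>e\<in>?H. c $ e) - (\<Sum>e\<in>?T. c $ e) = (\<Sum>e | head e = v. s $ e)
      - (\<Sum>e | c $ e \<in> \<int> \<and> head e = v. c $ e) + (\<Sum>e | c $ e \<in> \<int> \<and> tail e = v. c $ e)"
    using c[unfolded feasible_iff, rule_format, of v] by (simp add: split[of head] split[of tail])
  also have "\<dots> \<in> \<int>"
    by (intro Ints_add Ints_diff Ints_sum int s) auto
  finally have diff: "(\<Sum>e\<in>?H. c $ e) - (\<Sum>e\<in>?T. c $ e) \<in> \<int>" .
  have "?H \<noteq> {} \<or> ?T \<noteq> {}"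
    using v by auto
  then have "card ?H > 0 \<or> card ?T > 0"
    by (simp only: card_gt_0_iff) simp
  \<comment> \<open>With one incidence in all, \<open>diff\<close> says that \<open>c $ e\<close> or
    its negative is an integer for a fractional edge \<open>e\<close>.\<close>
  with less consider "card ?H = 1" "card ?T = 0" | "card ?H = 0" "card ?T = 1"
    by linarith
  then show False
  proof cases
    case 1
    from 1(1) obtain e where "?H = {e}" by (rule card_1_singletonE)
    moreover from 1(2) have "?T = {}" by (simp only: card_0_eq finite)
    ultimately have "c $ e \<in> \<int>" using diff by (simp only:) simp
    moreover have "e \<in> ?H" using \<open>?H = {e}\<close> by blast
    ultimately show False by simp
  next
    case 2
    from 2(2) obtain e where "?T = {e}" by (rule card_1_singletonE)
    moreover from 2(1) have "?H = {}" by (simp only: card_0_eq finite)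
    ultimately have "c $ e \<in> \<int>" using diff by (simp only:) simp
    moreover have "e \<in> ?T" using \<open>?T = {e}\<close> by blast
    ultimately show False by simp
  qed
qed

section \<open>Rounding a fractional flow at no extra cost\<close>

text \<open>A ratio test: move along \<open>d\<close> until the first coordinate reaches an integer.
  Integral coordinates stay fixed because \<open>d\<close> vanishes there, and the stopping
  coordinate leaves the fractional set.\<close>

lemma push_to_integer:
  fixes c d :: "real ^ 'e::finite"
  assumes "d \<noteq> 0" and supp: "\<And>e. c $ e \<in> \<int> \<Longrightarrow> d $ e = 0"
  obtains t where "t > 0"
    "\<And>e. (c + t *\<^sub>R d) $ e \<in> {of_int \<lfloor>c $ e\<rfloor> .. of_int \<lceil>c $ e\<rceil>}"
    "{e. (c + t *\<^sub>R d) $ e \<notin> \<int>} \<subset> {e. c $ e \<notin> \<int>}"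
proof -
  \<comment> \<open>For a moving coordinate, \<open>h e\<close> is the time at which it hits the
    integer ahead of it: the ceiling if it rises, the floor if it falls.\<close>
  define h where "h e = ((if d $ e > 0 then of_int \<lceil>c $ e\<rceil> else of_int \<lfloor>c $ e\<rfloor>) - c $ e) / d $ e" for e
  define t where "t = Min (h ` {e. d $ e \<noteq> 0})"
  have ne: "{e. d $ e \<noteq> 0} \<noteq> {}"
    using \<open>d \<noteq> 0\<close> by (auto simp: vec_eq_iff)
  have strict: "of_int \<lfloor>c $ e\<rfloor> < c $ e" "c $ e < of_int \<lceil>c $ e\<rceil>" if "d $ e \<noteq> 0" for e
  proof -
    have "c $ e \<notin> \<int>" using supp that by blast
    then have "of_int \<lfloor>c $ e\<rfloor> \<noteq> c $ e" "of_int \<lceil>c $ e\<rceil> \<noteq> c $ e"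
      by (metis Ints_of_int)+
    then show "of_int \<lfloor>c $ e\<rfloor> < c $ e" "c $ e < of_int \<lceil>c $ e\<rceil>"
      using of_int_floor_le[of "c $ e"] le_of_int_ceiling[of "c $ e"] by linarith+
  qed
  have hpos: "h e > 0" if "d $ e \<noteq> 0" for e
    using strict[OF that] that by (auto simp: h_def divide_neg_neg)
  have tpos: "t > 0"
    unfolding t_def using ne hpos by (subst Min_gr_iff) auto
  have le: "t \<le> h e" if "d $ e \<noteq> 0" for e
    unfolding t_def using that by (intro Min_le) auto
  have box: "(c + t *\<^sub>R d) $ e \<in> {of_int \<lfloor>c $ e\<rfloor> .. of_int \<lceil>c $ e\<rceil>}" for e
  proof (cases "d $ e" "0::real" rule: linorder_cases)
    case less
    then have "t * d $ e \<ge> h e * d $ e"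
      using le[of e] by (intro mult_right_mono_neg) auto
    moreover have "h e * d $ e = of_int \<lfloor>c $ e\<rfloor> - c $ e" "t * d $ e \<le> 0"
      using less tpos by (auto simp: h_def mult_le_0_iff)
    ultimately show ?thesis
      using le_of_int_ceiling[of "c $ e"] by (simp, linarith)
  next
    case greater
    then have "t * d $ e \<le> h e * d $ e"
      using le[of e] by (intro mult_right_mono) auto
    moreover have "h e * d $ e = of_int \<lceil>c $ e\<rceil> - c $ e" "t * d $ e \<ge> 0"
      using greater tpos by (auto simp: h_def)
    ultimately show ?thesis
      using of_int_floor_le[of "c $ e"] by (simp, linarith)
  qed simp
  have "t \<in> h ` {e. d $ e \<noteq> 0}"
    unfolding t_def using ne by (intro Min_in) auto
  then obtain e where e: "d $ e \<noteq> 0" "t = h e" by blast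
  have "(c + t *\<^sub>R d) $ e \<in> \<int>"
    using e by (simp add: h_def)
  moreover have "c $ e \<notin> \<int>"
    using supp e(1) by blast
  moreover have "{e. (c + t *\<^sub>R d) $ e \<notin> \<int>} \<subseteq> {e. c $ e \<notin> \<int>}"
    using supp by auto
  ultimately have "{e. (c + t *\<^sub>R d) $ e \<notin> \<int>} \<subset> {e. c $ e \<notin> \<int>}"
    by blast
  with tpos box show thesis by (rule that)
qed

text \<open>An integer-valued profile takes no value strictly between \<open>k\<close> and
  \<open>k + 1\<close>. So \<open>f x - y\<close> does not change sign as \<open>y\<close> runs
  through the cell, and \<open>\<bar>f x - y\<bar>\<close> is affine in \<open>y\<close> there;
  integration over \<open>x\<close> preserves this.\<close>

lemma Psi_affine_on_cell:
  assumes f: "integrable (edge_measure l) f" and int: "\<And>x. f x \<in> \<int>"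
    and cell: "a \<in> {of_int k .. of_int k + 1}" "b \<in> {of_int k .. of_int k + 1}"
    and uv: "u \<ge> 0" "v \<ge> 0" "u + v = 1"
  shows "Psi l f (u * a + v * b) = u * Psi l f a + v * Psi l f b"
proof -
  interpret finite_measure "edge_measure l"
    by (rule finite_measure_edge_measure)
  have "\<bar>f x - (u * a + v * b)\<bar> = u * \<bar>f x - a\<bar> + v * \<bar>f x - b\<bar>" for x
  proof -
    obtain m where m: "f x = of_int m"
      using int[of x] by (auto elim: Ints_cases)
    have decomp: "f x - (u * a + v * b) = u * (f x - a) + v * (f x - b)"
      using uv(3) by (simp add: algebra_simps flip: distrib_right)
    show ?thesis
    proof (cases "m \<le> k")
      case True
      then have "f x \<le> of_int k" by (simp add: m)
      then have le: "f x - a \<le> 0" "f x - b \<le> 0" using cell by auto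
      have "u * (f x - a) \<le> 0" "v * (f x - b) \<le> 0"
        using le uv by (auto intro: mult_nonneg_nonpos)
      then show ?thesis
        unfolding decomp using le by (simp add: abs_of_nonpos algebra_simps)
    next
      case False
      then have "of_int k + 1 \<le> f x" unfolding m by linarith
      then have ge: "f x - a \<ge> 0" "f x - b \<ge> 0" using cell by auto
      then show ?thesis
        unfolding decomp using uv by simp
    qed
  qed
  then show ?thesis
    using f by (simp add: Psi_eq borel_measurable_integrable)
qed

lemma total_cost_affine_on_cell:
  fixes a b :: "real ^ 'e::finite"
  assumes "\<And>e. integrable (edge_measure (len e)) (\<xi> e)" "\<And>e x. \<xi> e x \<in> \<int>"
    and "\<And>e. a $ e \<in> {of_int (k e) .. of_int (k e) + 1}"
    and "\<And>e. b $ e \<in> {of_int (k e) .. of_int (k e) + 1}"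
    and "u \<ge> 0" "v \<ge> 0" "u + v = 1"
  shows "total_cost len \<xi> (u *\<^sub>R a + v *\<^sub>R b) = u * total_cost len \<xi> a + v * total_cost len \<xi> b"
proof -
  have "Psi (len e) (\<xi> e) (u * a $ e + v * b $ e)
      = u * Psi (len e) (\<xi> e) (a $ e) + v * Psi (len e) (\<xi> e) (b $ e)" for e
    using assms by (intro Psi_affine_on_cell[where k = "k e"])
  then show ?thesis
    by (simp add: total_cost_def sum.distrib sum_distrib_left)
qed

text \<open>Pushing along \<open>d\<close> and along \<open>- d\<close> gives end points
  \<open>a\<close> and \<open>b\<close> of a segment through \<open>c\<close> inside one cell. The
  cost is affine on this segment, so one end point is no worse than \<open>c\<close>.\<close>

lemma exists_less_fractional:
  fixes c :: "real ^ 'e::finite"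
  assumes \<xi>: "\<And>e. integrable (edge_measure (len e)) (\<xi> e)" "\<And>e x. \<xi> e x \<in> \<int>"
    and s: "\<And>e. s $ e \<in> \<int>"
    and c: "c \<in> feasible tail head s" and frac: "{e. c $ e \<notin> \<int>} \<noteq> {}"
  obtains c' where "c' \<in> feasible tail head s" "{e. c' $ e \<notin> \<int>} \<subset> {e. c $ e \<notin> \<int>}"
    "total_cost len \<xi> c' \<le> total_cost len \<xi> c"
proof -
  obtain d where d: "d \<noteq> 0" "\<And>e. e \<notin> {e. c $ e \<notin> \<int>} \<Longrightarrow> d $ e = 0"
    "(incidence_at head - incidence_at tail) *v d = 0"
    using exists_circulation[OF frac fractional_degree[OF c s]] by blast
  obtain t where t: "t > 0"
    "\<And>e. (c + t *\<^sub>R d) $ e \<in> {of_int \<lfloor>c $ e\<rfloor> .. of_int \<lceil>c $ e\<rceil>}"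
    "{e. (c + t *\<^sub>R d) $ e \<notin> \<int>} \<subset> {e. c $ e \<notin> \<int>}"
    using push_to_integer[of d c] d by auto
  obtain r where r: "r > 0"
    "\<And>e. (c + r *\<^sub>R - d) $ e \<in> {of_int \<lfloor>c $ e\<rfloor> .. of_int \<lceil>c $ e\<rceil>}"
    "{e. (c + r *\<^sub>R - d) $ e \<notin> \<int>} \<subset> {e. c $ e \<notin> \<int>}"
    using push_to_integer[of "- d" c] d by auto
  define a b where "a = c + t *\<^sub>R d" and "b = c + r *\<^sub>R - d"
  have feas: "a \<in> feasible tail head s" "b \<in> feasible tail head s"
    using feasible_add_circulation[OF c d(3), of t] feasible_add_circulation[OF c d(3), of "- r"]
    by (simp_all add: a_def b_def)
  \<comment> \<open>An integral coordinate has equal floor and ceiling; its degenerate interval is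
    enlarged to a unit cell like all others.\<close>
  have ceil: "of_int \<lceil>x\<rceil> \<le> (of_int \<lfloor>x\<rfloor> + 1 :: real)" for x :: real
    using ceiling_diff_floor_le_1[of x] by linarith
  have cell: "a $ e \<in> {of_int \<lfloor>c $ e\<rfloor> .. of_int \<lfloor>c $ e\<rfloor> + 1}"
    "b $ e \<in> {of_int \<lfloor>c $ e\<rfloor> .. of_int \<lfloor>c $ e\<rfloor> + 1}" for e
    using t(2)[of e] r(2)[of e] ceil[of "c $ e"] unfolding a_def b_def atLeastAtMost_iff
    by (meson order_trans)+
  \<comment> \<open>The weights are chosen so that the displacements \<open>t *\<^sub>R d\<close>
    and \<open>r *\<^sub>R - d\<close> cancel in the combination.\<close>
  define u v where "u = r / (t + r)" and "v = t / (t + r)"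
  have uv: "u \<ge> 0" "v \<ge> 0" "u + v = 1"
    using t(1) r(1) by (auto simp: u_def v_def add_divide_distrib[symmetric] add.commute)
  have "u * t = v * r"
    by (simp add: u_def v_def)
  then have "(u * t) *\<^sub>R d = (v * r) *\<^sub>R d"
    by simp
  then have "u *\<^sub>R a + v *\<^sub>R b = (u + v) *\<^sub>R c"
    by (simp add: a_def b_def algebra_simps)
  then have "c = u *\<^sub>R a + v *\<^sub>R b"
    by (simp add: uv(3))
  then have eq: "total_cost len \<xi> c = u * total_cost len \<xi> a + v * total_cost len \<xi> b"
    using total_cost_affine_on_cell[where len = len and \<xi> = \<xi>, OF \<xi> cell uv] by simp
  \<comment> \<open>If both end points cost more than \<open>c\<close>, so would their convex
    combination. Signs are flipped because \<open>convex_bound_lt\<close> bounds from above.\<close>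
  have "total_cost len \<xi> a \<le> total_cost len \<xi> c \<or> total_cost len \<xi> b \<le> total_cost len \<xi> c"
    using convex_bound_lt[of "- total_cost len \<xi> a" "- total_cost len \<xi> c" "- total_cost len \<xi> b" u v]
      uv eq by fastforce
  then show thesis
    using that feas t(3) r(3) unfolding a_def b_def by blast
qed

text \<open>Descent on the number of fractional coordinates. It starts from an arbitrary feasible
  point, so the infima can be compared without exhibiting a minimizer.\<close>

lemma exists_integral_feasible:
  fixes c :: "real ^ 'e::finite"
  assumes \<xi>: "\<And>e. integrable (edge_measure (len e)) (\<xi> e)" "\<And>e x. \<xi> e x \<in> \<int>"
    and s: "\<And>e. s $ e \<in> \<int>"
    and "c \<in> feasible tail head s"
  shows "\<exists>c' \<in> feasible tail head s. (\<forall>e. c' $ e \<in> \<int>) \<and> total_cost len \<xi> c' \<le> total_cost len \<xi> c"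
  using assms(4)
proof (induction "card {e. c $ e \<notin> \<int>}" arbitrary: c rule: less_induct)
  case less
  show ?case
  proof (cases "{e. c $ e \<notin> \<int>} = {}")
    case True
    then show ?thesis using less.prems by auto
  next
    case False
    obtain c' where c': "c' \<in> feasible tail head s" "{e. c' $ e \<notin> \<int>} \<subset> {e. c $ e \<notin> \<int>}"
      "total_cost len \<xi> c' \<le> total_cost len \<xi> c"
      by (rule exists_less_fractional[where len = len and \<xi> = \<xi>, OF \<xi> s less.prems False])
    have "card {e. c' $ e \<notin> \<int>} < card {e. c $ e \<notin> \<int>}"
      using c'(2) by (intro psubset_card_mono) auto
    from less.hyps[OF this c'(1)] obtain c'' where "c'' \<in> feasible tail head s"
      "\<forall>e. c'' $ e \<in> \<int>" "total_cost len \<xi> c'' \<le> total_cost len \<xi> c'"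
      by blast
    with c'(3) show ?thesis
      by (intro bexI[of _ c'']) auto
  qed
qed

lemma bdd_below_total_cost: "bdd_below (total_cost len \<xi> ` A)"
  by (rule bdd_belowI2[where m = 0])
     (auto simp: total_cost_def Psi_def set_lebesgue_integral_def intro!: sum_nonneg integral_nonneg)

lemma real_optimum_eq_int_optimum:
  fixes s :: "real ^ 'e::finite"
  assumes \<xi>: "\<And>e. integrable (edge_measure (len e)) (\<xi> e)" "\<And>e x. \<xi> e x \<in> \<int>"
    and s: "\<And>e. s $ e \<in> \<int>"
  shows "real_optimum len tail head s \<xi> = int_optimum len tail head s \<xi>"
proof (cases "feasible tail head s = {}")
  \<comment> \<open>Both infima are then \<open>Inf {}\<close>, the same default real.\<close>
  case True
  then show ?thesis by (simp add: real_optimum_def int_optimum_def)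
next
  case False
  note ex = exists_integral_feasible[where len = len and \<xi> = \<xi>, OF \<xi> s]
  have ne: "{c \<in> feasible tail head s. \<forall>e. c $ e \<in> \<int>} \<noteq> {}"
    using ex False by fast
  show ?thesis
    unfolding real_optimum_def int_optimum_def
  proof (rule antisym)
    show "(INF c\<in>feasible tail head s. total_cost len \<xi> c)
        \<le> (INF c\<in>{c \<in> feasible tail head s. \<forall>e. c $ e \<in> \<int>}. total_cost len \<xi> c)"
      by (rule cINF_superset_mono[OF ne bdd_below_total_cost]) auto
    show "(INF c\<in>{c \<in> feasible tail head s. \<forall>e. c $ e \<in> \<int>}. total_cost len \<xi> c)
        \<le> (INF c\<in>feasible tail head s. total_cost len \<xi> c)"
      by (rule cINF_mono[OF False bdd_below_total_cost]) (use ex in blast)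
  qed
qed

section \<open>Dependence of the optimum on the profile, and the limit\<close>

lemma real_optimum_diff_le:
  assumes "\<And>c. \<bar>total_cost len \<xi> c - total_cost len \<eta> c\<bar> \<le> B"
  shows "\<bar>real_optimum len tail head s \<xi> - real_optimum len tail head s \<eta>\<bar> \<le> B"
proof (cases "feasible tail head s = {}")
  \<comment> \<open>Both optima are the default \<open>Inf {}\<close>, so their difference is 0; the
    assumption at \<open>c = 0\<close> supplies \<open>0 \<le> B\<close>.\<close>
  case True
  then show ?thesis
    using assms[of 0] by (simp add: real_optimum_def)
next
  case False
  \<comment> \<open>The one-sided estimate is stated for arbitrary profiles so that it can be used
    in both orders.\<close>
  have "real_optimum len tail head s \<xi> - B \<le> real_optimum len tail head s \<eta>"
    if "\<And>c. total_cost len \<xi> c \<le> total_cost len \<eta> c + B" for \<xi> \<eta>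
    unfolding real_optimum_def
    by (rule cINF_greatest[OF False])
       (metis cINF_lower[OF bdd_below_total_cost] diff_le_eq order_trans that)
  from this[of \<xi> \<eta>] this[of \<eta> \<xi>] assms show ?thesis
    by (smt (verit))
qed

lemma total_cost_diff_le:
  assumes "\<And>e. integrable (edge_measure (len e)) (\<xi> e)"
    and "\<And>e. integrable (edge_measure (len e)) (\<eta> e)"
  shows "\<bar>total_cost len \<xi> c - total_cost len \<eta> c\<bar>
    \<le> CARD('e) * (MAX e. L1_dist (len e) (\<xi> e) (\<eta> (e::'e::finite)))"
proof -
  have "\<bar>total_cost len \<xi> c - total_cost len \<eta> c\<bar>
      \<le> (\<Sum>e\<in>UNIV. \<bar>Psi (len e) (\<xi> e) (c $ e) - Psi (len e) (\<eta> e) (c $ e)\<bar>)"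
    unfolding total_cost_def sum_subtractf[symmetric] by (rule sum_abs)
  also have "\<dots> \<le> (\<Sum>e\<in>(UNIV::'e set). MAX e. L1_dist (len e) (\<xi> e) (\<eta> e))"
    by (intro sum_mono order_trans[OF Psi_diff_le_L1_dist] assms Max_ge) auto
  finally show ?thesis by simp
qed

theorem theorem3:
  fixes len :: "'e::finite \<Rightarrow> real"
    and tail head :: "'e \<Rightarrow> 'v::finite"
    and U V :: "('e \<times> real) set"
    and n :: nat
    and Q :: "real \<Rightarrow> 'e \<Rightarrow> real \<Rightarrow> real"
  assumes "\<And>e. len e \<ge> 0"
    and "U \<subseteq> locations len" and "V \<subseteq> locations len"
    and "finite U" and "finite V" and "card U = n" and "card V = n"
    and "\<And>\<epsilon> e. \<epsilon> > 0 \<Longrightarrow> C2_on (Q \<epsilon> e) {0..len e}"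
    and "\<And>\<epsilon> e. \<epsilon> > 0 \<Longrightarrow> pos_deriv_on (Q \<epsilon> e) {0..len e}"
    and "((\<lambda>\<epsilon>. MAX e. L1_dist (len e) (Q \<epsilon> e) (rearrangement (len e) (imbalance U V e)))
           \<longlongrightarrow> 0) (at_right 0)"
  shows "((\<lambda>\<epsilon>. \<bar>real_optimum len tail head (end_imbalance len U V) (Q \<epsilon>)
              - int_optimum len tail head (end_imbalance len U V) (imbalance U V)\<bar>)
           \<longlongrightarrow> 0) (at_right 0)"
proof -
  \<comment> \<open>\<open>R\<close> defines an intermediate problem: its costs agree with those of
    the imbalance, and its L1 distance to \<open>Q \<epsilon>\<close> tends to 0.\<close>
  define R where "R e = rearrangement (len e) (imbalance U V e)" for e
  have S: "integrable (edge_measure (len e)) (imbalance U V e)" for e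
    using assms(4,5) by (rule integrable_imbalance)
  have R: "integrable (edge_measure (len e)) (R e)" for e
    unfolding R_def by (rule integrable_rearrangement[OF assms(1) S])
  have "total_cost len R c = total_cost len (imbalance U V) c" for c
    using S by (simp add: total_cost_def R_def Psi_rearrangement assms(1) borel_measurable_integrable)
  then have "real_optimum len tail head (end_imbalance len U V) R
      = real_optimum len tail head (end_imbalance len U V) (imbalance U V)"
    by (simp add: real_optimum_def)
  \<comment> \<open>Imbalances are differences of cardinalities, so both the profile and the
    right-hand side of the constraint are integral.\<close>
  also have "\<dots> = int_optimum len tail head (end_imbalance len U V) (imbalance U V)"
    using S by (rule real_optimum_eq_int_optimum) (simp_all add: end_imbalance_def imbalance_def)
  finally have opt: "real_optimum len tail head (end_imbalance len U V) R
      = int_optimum len tail head (end_imbalance len U V) (imbalance U V)" .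
  have Q: "integrable (edge_measure (len e)) (Q \<epsilon> e)" if pos: "\<epsilon> > 0" for \<epsilon> e
  proof (rule integrable_continuous_edge)
    obtain Q' where "\<And>x. x \<in> {0..len e} \<Longrightarrow>
        (Q \<epsilon> e has_real_derivative Q' x) (at x within {0..len e})"
      using assms(8)[OF pos, of e] unfolding C2_on_def by blast
    then show "continuous_on {0..len e} (Q \<epsilon> e)"
      by (rule DERIV_continuous_on)
  qed
  show ?thesis
  proof (rule tendsto_sandwich[OF _ _ tendsto_const])
    show "((\<lambda>\<epsilon>. CARD('e) * (MAX e. L1_dist (len e) (Q \<epsilon> e) (R e))) \<longlongrightarrow> 0) (at_right 0)"
      unfolding R_def by (rule tendsto_mult_right_zero[OF assms(10)])
    show "\<forall>\<^sub>F \<epsilon> in at_right 0. \<bar>real_optimum len tail head (end_imbalance len U V) (Q \<epsilon>)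
        - int_optimum len tail head (end_imbalance len U V) (imbalance U V)\<bar>
        \<le> CARD('e) * (MAX e. L1_dist (len e) (Q \<epsilon> e) (R e))"
      \<comment> \<open>The regularity of \<open>Q \<epsilon>\<close>, and with it the estimate, is
        available only for \<open>\<epsilon> > 0\<close>, which holds eventually in
        \<open>at_right 0\<close>.\<close>
      using eventually_at_right_less[of "0::real"]
      by eventually_elim
         (unfold opt[symmetric], intro real_optimum_diff_le total_cost_diff_le Q R)
  qed auto
qed

end
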